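(* For every real number $x \ge 7$, the number of primes less than or equal to $x$ equals $$\pi(x) = 4 + \sum_{j=1}^{\left\lfloor \frac{x-1}{6} \right\rfloor} \lfloor S(6j+1) \rfloor + \sum_{j=1}^{\left\lfloor \frac{x+1}{6} \right\rfloor} \lfloor S(6j-1) \rfloor .$$
   Context: $\lfloor y \rfloor$ denotes the largest integer $\le y$. For a positive integer $m$ put $M(m)=\left\lfloor \frac{\lfloor \sqrt{m} \rfloor}{6} \right\rfloor$, $$S_1(m) = \frac{-1}{M(m)+1} \sum_{k=1}^{M(m)+1} \left\lfloor \left\lfloor \frac{m}{6k+1} \right\rfloor - \frac{m}{6k+1} \right\rfloor, \qquad S_2(m) = \frac{-1}{M(m)+1} \sum_{k=1}^{M(m)+1} \left\lfloor \left\lfloor \frac{m}{6k-1} \right\rfloor - \frac{m}{6k-1} \right\rfloor ,$$ and $S(m)=\frac{S_1(m)+S_2(m)}{2}$. *)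

theory Defs
  imports Complex_Main "HOL-Computational_Algebra.Primes"
begin

definition prime_count :: "real \<Rightarrow> nat" where
  "prime_count x = card {p :: nat. prime p \<and> real p \<le> x}"

text \<open>
  The functions below are meant for positive arguments. They are taken over the integers so that
  arguments such as \<open>6 * j - 1\<close> involve no truncated subtraction.
\<close>

definition M :: "int \<Rightarrow> int" where
  "M m = \<lfloor>real_of_int \<lfloor>sqrt (real_of_int m)\<rfloor> / 6\<rfloor>"

definition S1 :: "int \<Rightarrow> real" where
  "S1 m = - 1 / real_of_int (M m + 1) *
     (\<Sum>k = 1..M m + 1.
        real_of_int \<lfloor>real_of_int \<lfloor>real_of_int m / real_of_int (6 * k + 1)\<rfloor>
                       - real_of_int m / real_of_int (6 * k + 1)\<rfloor>)"

definition S2 :: "int \<Rightarrow> real" where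
  "S2 m = - 1 / real_of_int (M m + 1) *
     (\<Sum>k = 1..M m + 1.
        real_of_int \<lfloor>real_of_int \<lfloor>real_of_int m / real_of_int (6 * k - 1)\<rfloor>
                       - real_of_int m / real_of_int (6 * k - 1)\<rfloor>)"

definition S :: "int \<Rightarrow> real" where
  "S m = (S1 m + S2 m) / 2"

end

theory Submission imports Defs
begin

text \<open>
  The summand for a divisor \<open>d\<close> is \<open>0\<close> if \<open>d\<close> divides \<open>m\<close> and \<open>- 1\<close> otherwise, so \<open>S m\<close> is the
  proportion of the trial divisors \<open>6 k \<plusminus> 1\<close>, \<open>1 \<le> k \<le> M m + 1\<close>, that do not divide \<open>m\<close>, and its floor is
  \<open>1\<close> or \<open>0\<close> according to whether none of them does. For \<open>m\<close> prime to \<open>6\<close> the trial divisors contain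
  every candidate up to \<open>sqrt m\<close>, and for \<open>m > 7\<close> they are all smaller than \<open>m\<close>, so the floor is the
  indicator of primality there. The primes \<open>5\<close> and \<open>7\<close> are their own trial divisors and hence are not
  counted by the sums; together with \<open>2\<close> and \<open>3\<close> they make up the constant \<open>4\<close>.
\<close>

text \<open>For every real y, the difference floor y - y lies in (-1, 0] and vanishes exactly when y
  is an integer.\<close>

lemma floor_floor_divide_diff:
  fixes m d :: int
  assumes "d > 0"
  shows "\<lfloor>real_of_int \<lfloor>real_of_int m / real_of_int d\<rfloor> - real_of_int m / real_of_int d\<rfloor>
         = (if d dvd m then 0 else - 1)"
proof (cases "d dvd m")
  case True
  then obtain n where "m = d * n" by (rule dvdE)
  then show ?thesis using assms by simp
next
  case False
  have "real_of_int \<lfloor>real_of_int m / real_of_int d\<rfloor> \<noteq> real_of_int m / real_of_int d"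
  proof
    assume eq: "real_of_int \<lfloor>real_of_int m / real_of_int d\<rfloor> = real_of_int m / real_of_int d"
    have "real_of_int m = real_of_int d * (real_of_int m / real_of_int d)"
      using assms by simp
    then have "real_of_int m = real_of_int (d * \<lfloor>real_of_int m / real_of_int d\<rfloor>)"
      by (simp only: of_int_mult eq)
    then have "m = d * \<lfloor>real_of_int m / real_of_int d\<rfloor>"
      by (simp only: of_int_eq_iff)
    with False show False by (metis dvd_triv_left)
  qed
  then have "\<lfloor>real_of_int \<lfloor>real_of_int m / real_of_int d\<rfloor> - real_of_int m / real_of_int d\<rfloor> = - 1"
    by (intro floor_unique) linarith+
  with False show ?thesis by simp
qed

lemma M_eq: "M m = \<lfloor>sqrt (real_of_int m)\<rfloor> div 6"
  using floor_divide_of_int_eq[of "\<lfloor>sqrt (real_of_int m)\<rfloor>" 6, where 'a = real]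
  by (simp add: M_def)

lemma M_nonneg: "m \<ge> 0 \<Longrightarrow> M m \<ge> 0"
  by (simp add: M_eq pos_imp_zdiv_nonneg_iff)

lemma S_eq:
  "S m = (\<Sum>k = 1..M m + 1. of_bool (\<not> 6 * k + 1 dvd m) + of_bool (\<not> 6 * k - 1 dvd m))
         / (2 * real_of_int (M m + 1))"
proof -
  \<comment> \<open>The offset \<open>c\<close> treats \<open>S1\<close> and \<open>S2\<close> at
    once; \<open>c \<ge> - 1\<close> keeps every divisor positive.\<close>
  have "(\<Sum>k = 1..M m + 1. real_of_int \<lfloor>real_of_int \<lfloor>real_of_int m / real_of_int (6 * k + c)\<rfloor>
          - real_of_int m / real_of_int (6 * k + c)\<rfloor>)
        = - (\<Sum>k = 1..M m + 1. of_bool (\<not> 6 * k + c dvd m))" if "c \<ge> - 1" for c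
    unfolding sum_negf[symmetric]
  proof (rule sum.cong)
    fix k assume "k \<in> {1..M m + 1}"
    then have "6 * k + c > 0" using that by auto
    then show "real_of_int \<lfloor>real_of_int \<lfloor>real_of_int m / real_of_int (6 * k + c)\<rfloor>
          - real_of_int m / real_of_int (6 * k + c)\<rfloor> = - of_bool (\<not> 6 * k + c dvd m)"
      by (subst floor_floor_divide_diff) auto
  qed simp
  from this[of 1] this[of "- 1"] show ?thesis
    unfolding S_def S1_def S2_def by (simp add: sum.distrib add_divide_distrib mult.commute[of _ 2])
qed

lemma floor_S:
  assumes "m \<ge> 0"
  shows "\<lfloor>S m\<rfloor> = of_bool (\<forall>k\<in>{1..M m + 1}. \<not> 6 * k + 1 dvd m \<and> \<not> 6 * k - 1 dvd m)"
proof -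
  define f where "f k = (of_bool (\<not> 6 * k + 1 dvd m) + of_bool (\<not> 6 * k - 1 dvd m) :: real)" for k
  have M: "M m \<ge> 0" using assms by (rule M_nonneg)
  have S: "S m = sum f {1..M m + 1} / (2 * real_of_int (M m + 1))"
    unfolding S_eq f_def ..
  \<comment> \<open>The denominator becomes the sum of the termwise bound 2 of \<open>f\<close>, so
    a single term below 2 forces \<open>S m < 1\<close>.\<close>
  have const: "(\<Sum>k = 1..M m + 1. 2) = 2 * real_of_int (M m + 1)"
    using M by simp
  show ?thesis
  proof (cases "\<forall>k\<in>{1..M m + 1}. \<not> 6 * k + 1 dvd m \<and> \<not> 6 * k - 1 dvd m")
    case True
    then have "sum f {1..M m + 1} = (\<Sum>k = 1..M m + 1. 2)"
      by (intro sum.cong) (auto simp: f_def)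
    then have "S m = 1" unfolding S const using M by simp
    with True show ?thesis by simp
  next
    case False
    have "sum f {1..M m + 1} < (\<Sum>k = 1..M m + 1. 2)"
      using False by (intro sum_strict_mono_ex1) (auto simp: f_def)
    then have "S m < 1" unfolding S const using M by simp
    moreover have "S m \<ge> 0" unfolding S using M
      by (intro divide_nonneg_nonneg sum_nonneg) (auto simp: f_def)
    ultimately have "\<lfloor>S m\<rfloor> = 0" by (simp add: floor_eq_iff)
    with False show ?thesis by simp
  qed
qed

text \<open>The largest trial divisor is 6 (M m + 1) + 1 = 6 M m + 7. Here 6 M m \<le> sqrt m \<le>
  m / 3, and m / 3 + 7 < m holds for integers from 11 on.\<close>

lemma six_M_less:
  fixes m :: int
  assumes "m \<ge> 11"
  shows "6 * M m + 7 < m"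
proof -
  have "9 * real_of_int m \<le> real_of_int m * real_of_int m"
    using assms by (intro mult_right_mono) auto
  then have "sqrt (real_of_int m) \<le> real_of_int m / 3"
    using assms by (intro real_le_lsqrt) (auto simp: power2_eq_square)
  moreover have "real_of_int (6 * M m) \<le> sqrt (real_of_int m)"
  proof -
    have "6 * M m \<le> \<lfloor>sqrt (real_of_int m)\<rfloor>" unfolding M_eq by simp
    then show ?thesis by linarith
  qed
  ultimately show ?thesis using assms by linarith
qed

text \<open>In a nontrivial factorization m = a b, the smaller factor has square at most m.\<close>

lemma not_prime_int_divisor:
  fixes m :: int
  assumes "m > 1" "\<not> prime m"
  obtains a where "a > 1" "a dvd m" "a * a \<le> m"
proof -
  obtain a where a: "a \<ge> 0" "a dvd m" "a \<noteq> 1" "a \<noteq> m"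
    using assms unfolding prime_int_iff by auto
  then obtain b where b: "m = a * b" by auto
  have "a > 0" using a assms b by (cases "a = 0") auto
  then have "b > 0" using assms(1) b zero_less_mult_pos[of a b] by simp
  have "b \<noteq> 1" using a b by auto
  show thesis
  proof (cases "a \<le> b")
    case True
    then show thesis
      using that[of a] a b \<open>a > 0\<close> by (auto intro: mult_left_mono)
  next
    case False
    then show thesis
      using that[of b] b \<open>b > 0\<close> \<open>b \<noteq> 1\<close> by (auto intro: mult_right_mono)
  qed
qed

lemma not_2_3_dvdE:
  fixes a :: int
  assumes "a > 1" "\<not> 2 dvd a" "\<not> 3 dvd a"
  obtains k where "k \<ge> 1" "a = 6 * k + 1 \<or> a = 6 * k - 1"
proof -
  \<comment> \<open>One witness serves both residues: a + 1 is 6 k + 2 or 6 k.\<close>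
  have "a = 6 * ((a + 1) div 6) + 1 \<or> a = 6 * ((a + 1) div 6) - 1"
    using assms(2,3) by presburger
  with assms(1) show thesis by (intro that[of "(a + 1) div 6"]) auto
qed

lemma floor_S_eq_prime:
  fixes m :: int
  assumes "m \<ge> 5" "\<not> 2 dvd m" "\<not> 3 dvd m"
  shows "\<lfloor>S m\<rfloor> = of_bool (prime m \<and> m > 7)"
proof -
  have M: "M m \<ge> 0" using assms by (intro M_nonneg) auto
  have "(\<forall>k\<in>{1..M m + 1}. \<not> 6 * k + 1 dvd m \<and> \<not> 6 * k - 1 dvd m) \<longleftrightarrow> prime m \<and> m > 7"
    (is "?none \<longleftrightarrow> _")
  proof
    assume none: ?none
    \<comment> \<open>The index k = 1 contributes the trial divisors 7 and 5.\<close>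
    have "m \<noteq> 5" "m \<noteq> 7" using none M by (auto dest: bspec[of _ _ 1])
    moreover have "m \<noteq> 6" using assms by auto
    ultimately have "m > 7" using assms by auto
    moreover have "prime m"
    proof (rule ccontr)
      assume "\<not> prime m"
      then obtain a where a: "a > 1" "a dvd m" "a * a \<le> m"
        using assms not_prime_int_divisor[of m] by auto
      have "\<not> 2 dvd a" "\<not> 3 dvd a"
        using a assms dvd_trans by blast+
      with a obtain k where k: "k \<ge> 1" "a = 6 * k + 1 \<or> a = 6 * k - 1"
        using not_2_3_dvdE[of a] by blast
      have "real_of_int a ^ 2 \<le> real_of_int m"
        using a(3) by (metis of_int_le_iff of_int_mult power2_eq_square)
      then have "a \<le> \<lfloor>sqrt (real_of_int m)\<rfloor>"
        by (simp add: le_floor_iff real_le_rsqrt)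
      \<comment> \<open>The extra index matters: if floor (sqrt m) = 6 q + 5, the candidate 6 (q +
        1) - 1 has k = M m + 1.\<close>
      then have "k \<le> M m + 1"
        using k unfolding M_eq by presburger
      with k a none show False by auto
    qed
    ultimately show "prime m \<and> m > 7" by blast
  next
    assume m: "prime m \<and> m > 7"
    \<comment> \<open>Coprimality to 6 closes the gap between 7 and the bound 11 of
      \<open>six_M_less\<close>.\<close>
    have "m \<noteq> 8" "m \<noteq> 9" "m \<noteq> 10" using assms by auto
    with m have "6 * M m + 7 < m" by (intro six_M_less) auto
    then have "\<not> d dvd m" if "1 < d" "d \<le> 6 * M m + 7" for d
      using that m unfolding prime_int_iff by (auto dest!: spec[of _ d])
    then show ?none by auto
  qed
  with assms show ?thesis by (subst floor_S) auto
qed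

lemma prime_int_cases_mod_6:
  fixes p :: int
  assumes "prime p"
  shows "p \<in> {2, 3, 5, 7} \<or> p > 7 \<and> (\<exists>j\<ge>1. p = 6 * j + 1 \<or> p = 6 * j - 1)"
proof (cases "2 dvd p \<or> 3 dvd p")
  case True
  then have "p = 2 \<or> p = 3"
    using assms primes_dvd_imp_eq[of 2 p] primes_dvd_imp_eq[of 3 p] by auto
  then show ?thesis by auto
next
  case False
  moreover have "p > 1" using assms by (rule prime_gt_1_int)
  ultimately obtain k where k: "k \<ge> 1" "p = 6 * k + 1 \<or> p = 6 * k - 1"
    using not_2_3_dvdE[of p] by blast
  then have "p = 5 \<or> p = 7 \<or> p > 7" by presburger
  with k show ?thesis by blast
qed

theorem theorem5:
  fixes x :: real
  assumes "x \<ge> 7"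
  shows "int (prime_count x) =
    4 + (\<Sum>j = 1..\<lfloor>(x - 1) / 6\<rfloor>. \<lfloor>S (6 * j + 1)\<rfloor>)
      + (\<Sum>j = 1..\<lfloor>(x + 1) / 6\<rfloor>. \<lfloor>S (6 * j - 1)\<rfloor>)"
proof -
  \<comment> \<open>For c = 1 and c = -1, \<open>P c\<close> is the set of primes in (7, x]
    congruent to c modulo 6, and \<open>A c\<close> indexes it.\<close>
  define A where "A c = {j \<in> {1..\<lfloor>(x - real_of_int c) / 6\<rfloor>}. prime (6 * j + c) \<and> 6 * j + c > 7}"
    for c :: int
  define P where "P c = (\<lambda>j. 6 * j + c) ` A c" for c
  have le_iff: "j \<le> \<lfloor>(x - real_of_int c) / 6\<rfloor> \<longleftrightarrow> real_of_int (6 * j + c) \<le> x" for j c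
    by (auto simp: le_floor_iff field_simps)
  have fin: "finite (P c)" for c 
    unfolding P_def A_def by (intro finite_imageI finite_Collect_conjI) simp
  have sum_eq: "(\<Sum>j = 1..\<lfloor>(x - real_of_int c) / 6\<rfloor>. \<lfloor>S (6 * j + c)\<rfloor>) = int (card (P c))"
    if c: "c = 1 \<or> c = - 1" for c
  proof -
    have "(\<Sum>j = 1..\<lfloor>(x - real_of_int c) / 6\<rfloor>. \<lfloor>S (6 * j + c)\<rfloor>)
        = (\<Sum>j = 1..\<lfloor>(x - real_of_int c) / 6\<rfloor>. of_bool (prime (6 * j + c) \<and> 6 * j + c > 7))"
    proof (intro sum.cong refl floor_S_eq_prime)
      fix j assume "j \<in> {1..\<lfloor>(x - real_of_int c) / 6\<rfloor>}"
      then show "6 * j + c \<ge> 5" using c by auto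
      show "\<not> 2 dvd 6 * j + c" "\<not> 3 dvd 6 * j + c" using c by presburger+
    qed
    also have "\<dots> = int (card (A c))"
      \<comment> \<open>A sum of indicators is the size of an intersection, which
        \<open>Int_def\<close> rewrites as the comprehension defining \<open>A c\<close>.\<close>
      unfolding A_def by (simp add: Int_def)
    also have "card (A c) = card (P c)"
      unfolding P_def by (intro card_image[symmetric] inj_onI) simp
    finally show ?thesis .
  qed
  have small: "prime (2 :: int)" "prime (3 :: int)" "prime (5 :: int)" "prime (7 :: int)"
    by simp_all
  have "prime_count x = card (int ` {p. prime p \<and> real p \<le> x})"
    unfolding prime_count_def by (intro card_image[symmetric]) simp
  also have "int ` {p. prime p \<and> real p \<le> x} = {p. prime p \<and> real_of_int p \<le> x}"
  proof (intro equalityI subsetI)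
    fix p assume p: "p \<in> {p. prime p \<and> real_of_int p \<le> x}"
    then obtain n where "p = int n"
      using prime_ge_0_int nonneg_int_cases by blast
    with p show "p \<in> int ` {p. prime p \<and> real p \<le> x}" by simp
  qed auto
  also have "\<dots> = {2, 3, 5, 7} \<union> (P 1 \<union> P (- 1))"
  proof (intro equalityI subsetI)
    fix p assume "p \<in> {p. prime p \<and> real_of_int p \<le> x}"
    then show "p \<in> {2, 3, 5, 7} \<union> (P 1 \<union> P (- 1))"
      using prime_int_cases_mod_6[of p]
      unfolding P_def A_def atLeastAtMost_iff le_iff by auto
  next
    fix p assume "p \<in> {2, 3, 5, 7} \<union> (P 1 \<union> P (- 1))"
    then show "p \<in> {p. prime p \<and> real_of_int p \<le> x}"
      using assms small unfolding P_def A_def atLeastAtMost_iff le_iff by auto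
  qed
  also have "card \<dots> = 4 + card (P 1 \<union> P (- 1))"
  proof -
    \<comment> \<open>The condition \<open>6 * j + c > 7\<close> in \<open>A\<close> prevents 5 and
      7 from being counted twice.\<close>
    have "{2, 3, 5, 7} \<inter> (P 1 \<union> P (- 1)) = {}" by (auto simp: P_def A_def)
    then show ?thesis by (subst card_Un_disjoint) (simp_all add: fin)
  qed
  also have "card (P 1 \<union> P (- 1)) = card (P 1) + card (P (- 1))"
  proof (rule card_Un_disjoint)
    have "6 * i + 1 \<noteq> 6 * j + (- 1)" for i j :: int by presburger
    then show "P 1 \<inter> P (- 1) = {}" by (auto simp: P_def)
  qed (use fin in auto)
  finally show ?thesis using sum_eq[of 1] sum_eq[of "- 1"] by simp
qed

end
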